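(* Let $X\subseteq\mathbb{R}^n$ be closed, let $R:X\to\mathbb{R}^n$, and let $X_{\mathrm{fix}}:=\{x\in X\mid R(x)=0\}$. Assume that $X_{\mathrm{fix}}$ is nonempty and closed, and that for some $\alpha\in(0,1)$ and $\mu\ge1$, $$d_S\!\left(x+\tfrac1\alpha R(x),\,x'+\tfrac1\alpha R(x')\right)\le\|x-x'\|_S,\qquad d_S(x,X_{\mathrm{fix}})\le\mu\|R(x)\|_S$$ for all $x,x'\in X$. Then, with $$c_S:=1-\sqrt{1-\frac{1-\alpha}{\alpha\mu^2}},$$ it holds that $$d_S(x+R(x),\bar x_x)\le(1-c_S)\,d_S(x,\bar x_x)$$ for all $x\in X$ and all $\bar x_x\in\arg\inf_{y\in X_{\mathrm{fix}}}d_S(x,y)$.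
   Context: $\|\cdot\|_S$ is a norm on $\mathbb{R}^n$ induced by an inner product, $d_S(x,x')=\|x-x'\|_S$, and $d_S(x,X')=\inf_{y\in X'}d_S(x,y)$ for a set $X'$. $\arg\inf_{y\in X_{\mathrm{fix}}}d_S(x,y)$ is the set of points of $X_{\mathrm{fix}}$ attaining the distance from $x$. *)

theory Defs
  imports "HOL-Analysis.Analysis"
begin

text \<open>The inner product is arbitrary and need not be the standard one of the type class;
  it is therefore an explicit parameter \<open>S\<close>.\<close>

definition inner_product :: "(real ^ 'n \<Rightarrow> real ^ 'n \<Rightarrow> real) \<Rightarrow> bool" where
  "inner_product S \<longleftrightarrow>
     bilinear S \<and> (\<forall>x y. S x y = S y x) \<and> (\<forall>x. x \<noteq> 0 \<longrightarrow> 0 < S x x)"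

definition norm_S :: "(real ^ 'n \<Rightarrow> real ^ 'n \<Rightarrow> real) \<Rightarrow> real ^ 'n \<Rightarrow> real" where
  "norm_S S x = sqrt (S x x)"

definition d_S :: "(real ^ 'n \<Rightarrow> real ^ 'n \<Rightarrow> real) \<Rightarrow> real ^ 'n \<Rightarrow> real ^ 'n \<Rightarrow> real" where
  "d_S S x x' = norm_S S (x - x')"

text \<open>As an infimum of reals, this is meaningful only for nonempty \<open>Y\<close>.\<close>

definition setdist_S ::
  "(real ^ 'n \<Rightarrow> real ^ 'n \<Rightarrow> real) \<Rightarrow> real ^ 'n \<Rightarrow> (real ^ 'n) set \<Rightarrow> real" where
  "setdist_S S x Y = (INF y\<in>Y. d_S S x y)"

definition arginf_S ::
  "(real ^ 'n \<Rightarrow> real ^ 'n \<Rightarrow> real) \<Rightarrow> real ^ 'n \<Rightarrow> (real ^ 'n) set \<Rightarrow> (real ^ 'n) set" where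
  "arginf_S S x Y = {y \<in> Y. d_S S x y = setdist_S S x Y}"

text \<open>A map from \<open>X\<close> to Euclidean space is a total function \<open>R\<close> of which only the values
  on \<open>X\<close> are used.\<close>

definition X_fix :: "(real ^ 'n) set \<Rightarrow> (real ^ 'n \<Rightarrow> real ^ 'n) \<Rightarrow> (real ^ 'n) set" where
  "X_fix X R = {x \<in> X. R x = 0}"

text \<open>The root is real under the hypotheses of the theorem unless every point of \<open>X\<close> is a zero
  of \<open>R\<close>. In that case the radicand may be negative, and \<open>sqrt\<close> then returns the negative of the
  root of its absolute value.\<close>

definition c_S :: "real \<Rightarrow> real \<Rightarrow> real" where
  "c_S \<alpha> \<mu> = 1 - sqrt (1 - (1 - \<alpha>) / (\<alpha> * \<mu>\<^sup>2))"

end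

theory Submission
  imports Defs
begin

text \<open>
  Put \<open>u = x - xbar\<close> and \<open>r = R x\<close>. Since \<open>R xbar = 0\<close>, the nonexpansiveness hypothesis at
  \<open>x, xbar\<close> says that moving from \<open>u\<close> by the long step \<open>r / \<alpha>\<close> does not increase the norm. The
  squared norm of \<open>u + t r\<close> is a quadratic polynomial in \<open>t\<close> with leading coefficient
  \<open>S r r\<close>, so at the shorter step \<open>t = 1\<close> it lies below its chord over \<open>[0, 1 / \<alpha>]\<close> by exactly
  \<open>(1 / \<alpha> - 1) * S r r\<close> (lemma \<open>averaged_step_decrease\<close>). The error bound
  \<open>d_S(x, X_fix) \<le> \<mu> * norm(r)\<close>, whose left side is the norm of \<open>u\<close> because \<open>xbar\<close> attains the
  distance, makes this gain at least the fraction \<open>(1 - \<alpha>) / (\<alpha> * \<mu>\<^sup>2)\<close> of \<open>S u u\<close>. Square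
  roots turn the resulting contraction of squared norms into the claim.
\<close>

lemma inner_product_self_add_scaleR:
  assumes "inner_product S"
  shows "S (u + t *\<^sub>R r) (u + t *\<^sub>R r) = S u u + 2 * t * S u r + t\<^sup>2 * S r r"
proof -
  have bil: "bilinear S" and sym: "S r u = S u r"
    using assms by (auto simp: inner_product_def)
  show ?thesis
    using sym by (simp add: bilinear_ladd[OF bil] bilinear_radd[OF bil]
      bilinear_lmul[OF bil] bilinear_rmul[OF bil] power2_eq_square algebra_simps)
qed

text \<open>Expanding the square turns the hypothesis into \<open>2 * S u r \<le> - S r r / \<alpha>\<close>; this cross term
  competes with the term \<open>S r r\<close> that the unit step adds.\<close>

lemma averaged_step_decrease:
  assumes "inner_product S" and "0 < \<alpha>"
    and "norm_S S (u + (1 / \<alpha>) *\<^sub>R r) \<le> norm_S S u"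
  shows "S (u + r) (u + r) \<le> S u u - (1 - \<alpha>) / \<alpha> * S r r"
proof -
  have "2 * (1 / \<alpha>) * S u r + (1 / \<alpha>)\<^sup>2 * S r r \<le> 0"
    using assms(3) inner_product_self_add_scaleR[OF assms(1), of u "1 / \<alpha>" r]
    by (simp add: norm_S_def)
  then have "\<alpha> * (2 * (1 / \<alpha>) * S u r + (1 / \<alpha>)\<^sup>2 * S r r) \<le> 0"
    using assms(2) by (simp add: mult_le_0_iff)
  also have "\<alpha> * (2 * (1 / \<alpha>) * S u r + (1 / \<alpha>)\<^sup>2 * S r r) = 2 * S u r + S r r / \<alpha>"
    using assms(2) by (simp add: power2_eq_square field_simps)
  finally have "2 * S u r + S r r / \<alpha> \<le> 0" .
  moreover have "(1 - \<alpha>) / \<alpha> * S r r = S r r / \<alpha> - S r r"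
    using assms(2) by (simp add: field_simps)
  ultimately show ?thesis
    using inner_product_self_add_scaleR[OF assms(1), of u 1 r] by simp
qed

lemma norm_S_le_mult_imp_square_le:
  assumes "0 \<le> \<mu>" and "norm_S S u \<le> \<mu> * norm_S S r"
  shows "S u u \<le> \<mu>\<^sup>2 * S r r"
proof -
  have "\<mu> * norm_S S r = sqrt (\<mu>\<^sup>2 * S r r)"
    using assms(1) by (simp add: norm_S_def real_sqrt_mult)
  then show ?thesis
    using assms(2) by (simp add: norm_S_def)
qed

theorem lemma1:
  fixes S :: "real ^ 'n \<Rightarrow> real ^ 'n \<Rightarrow> real"
    and X :: "(real ^ 'n) set"
    and R :: "real ^ 'n \<Rightarrow> real ^ 'n"
    and \<alpha> \<mu> :: real
  assumes "inner_product S"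
    and "closed X"
    and "X_fix X R \<noteq> {}"
    and "closed (X_fix X R)"
    and "0 < \<alpha>" and "\<alpha> < 1" and "1 \<le> \<mu>"
    and "\<And>x x'. x \<in> X \<Longrightarrow> x' \<in> X \<Longrightarrow>
           d_S S (x + (1 / \<alpha>) *\<^sub>R R x) (x' + (1 / \<alpha>) *\<^sub>R R x') \<le> norm_S S (x - x')"
    and "\<And>x. x \<in> X \<Longrightarrow> setdist_S S x (X_fix X R) \<le> \<mu> * norm_S S (R x)"
  shows "\<forall>x\<in>X. \<forall>xbar\<in>arginf_S S x (X_fix X R).
           d_S S (x + R x) xbar \<le> (1 - c_S \<alpha> \<mu>) * d_S S x xbar"
proof (intro ballI)
  fix x xbar
  assume x: "x \<in> X" and xbar: "xbar \<in> arginf_S S x (X_fix X R)"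
  define u where "u = x - xbar"
  define r where "r = R x"
  have zero: "xbar \<in> X" "R xbar = 0"
    and attained: "setdist_S S x (X_fix X R) = norm_S S u"
    using xbar by (auto simp: arginf_S_def X_fix_def d_S_def u_def)
  have "norm_S S (u + (1 / \<alpha>) *\<^sub>R r) \<le> norm_S S u"
    using assms(8)[OF x zero(1)] zero(2) by (simp add: d_S_def u_def r_def algebra_simps)
  note decrease = averaged_step_decrease[OF assms(1,5) this]
  have "S u u \<le> \<mu>\<^sup>2 * S r r"
    using norm_S_le_mult_imp_square_le[of \<mu> S u r] assms(7) assms(9)[OF x] attained
    by (simp add: r_def)
  then have "S u u / \<mu>\<^sup>2 \<le> S r r"
    using assms(7) by (simp add: divide_le_eq mult.commute)
  then have "(1 - \<alpha>) / \<alpha> * (S u u / \<mu>\<^sup>2) \<le> (1 - \<alpha>) / \<alpha> * S r r"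
    using assms(5,6) by (intro mult_left_mono) auto
  with decrease have "S (u + r) (u + r) \<le> (1 - (1 - \<alpha>) / (\<alpha> * \<mu>\<^sup>2)) * S u u"
    by (simp add: algebra_simps)
  \<comment> \<open>\<open>sqrt\<close>, extended as an odd function, is monotone and multiplicative on all reals, so this
    step also covers a negative radicand.\<close>
  then have "norm_S S (u + r) \<le> (1 - c_S \<alpha> \<mu>) * norm_S S u"
    by (simp add: norm_S_def c_S_def flip: real_sqrt_mult)
  then show "d_S S (x + R x) xbar \<le> (1 - c_S \<alpha> \<mu>) * d_S S x xbar"
    by (simp add: d_S_def u_def r_def add_diff_eq diff_add_eq)
qed

end
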